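(* For any field $\mathbb{F}$ and positive integers $m,r$, \[ \bar{\mathcal{H}}_f(M_r(K_m);\mathbb{F}) = m + \frac{1}{\sum_{k=0}^{r-1}(m-1)^k}, \] where $K_m$ is the complete graph on $m$ vertices (with the convention $0^0=1$).
   Context: For a simple graph $G$ and positive integer $r$, the generalized Mycielskian $M_r(G)$ has vertex set $V(G)\times\{0,1,\dots,r-1\}\cup\{z\}$ and edge set consisting of: $\{(v,0),(w,0)\}$ for $\{v,w\}\in E(G)$; $\{(v,i),(w,j)\}$ for $\{v,w\}\in E(G)$ and $|i-j|=1$; and $\{(v,r-1),z\}$ for all $v\in V(G)$. For a field $\mathbb{F}$, a collection $\{X_v\subseteq\mathbb{F}^n : v\in V(G)\}$ is a dual $(n,d)$-representation of $G$ over $\mathbb{F}$ if for every vertex $v$: $X_v$ is a subspace of $\mathbb{F}^n$, $\dim X_v=d$, and $X_v\cap\left(\sum_{w\in N(v)}X_w\right)=\{0\}$, where $N(v)$ is the neighborhood of $v$ and the sum is the subspace sum. The complementary fractional Haemers bound is $\bar{\mathcal{H}}_f(G;\mathbb{F})=\inf\{n/d : G \text{ has a dual }(n,d)\text{-representation over }\mathbb{F}\}$. *)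

theory Defs
  imports Complex_Main "HOL-Library.Function_Algebras"
begin

section \<open>Simple graphs\<close>

type_synonym 'v graph = "'v set \<times> 'v set set"

abbreviation verts :: "'v graph \<Rightarrow> 'v set" where
  "verts G \<equiv> fst G"

abbreviation edges :: "'v graph \<Rightarrow> 'v set set" where
  "edges G \<equiv> snd G"

definition simple_graph :: "'v graph \<Rightarrow> bool" where
  "simple_graph G \<longleftrightarrow> (\<forall>e\<in>edges G. e \<subseteq> verts G \<and> card e = 2)"

definition neighbourhood :: "'v graph \<Rightarrow> 'v \<Rightarrow> 'v set" where
  "neighbourhood G v = {w. {v, w} \<in> edges G}"

definition complete_graph :: "nat \<Rightarrow> nat graph" where
  "complete_graph m = ({..<m}, {{v, w} |v w. v < m \<and> w < m \<and> v \<noteq> w})"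

lemma simple_graph_complete_graph: "simple_graph (complete_graph m)"
  by (auto simp: simple_graph_def complete_graph_def)

section \<open>Generalized Mycielskians\<close>

datatype 'v myc = Copy 'v nat | Apex

definition mycielskian :: "nat \<Rightarrow> 'v graph \<Rightarrow> 'v myc graph" where
  "mycielskian r G =
    ({Copy v i |v i. v \<in> verts G \<and> i < r} \<union> {Apex},
     {{Copy v 0, Copy w 0} |v w. {v, w} \<in> edges G} \<union>
     {{Copy v i, Copy w j} |v w i j.
        {v, w} \<in> edges G \<and> i < r \<and> j < r \<and> \<bar>int i - int j\<bar> = 1} \<union>
     {{Copy v (r - 1), Apex} |v. v \<in> verts G})"

lemma simple_graph_mycielskian:
  assumes "simple_graph G" "r > 0"
  shows "simple_graph (mycielskian r G)"
proof -
  have "v \<in> verts G \<and> w \<in> verts G \<and> v \<noteq> w" if "{v, w} \<in> edges G" for v w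
    using assms(1) that by (force simp: simple_graph_def)
  then show ?thesis
    using assms(2) by (fastforce simp: simple_graph_def mycielskian_def card_2_iff)
qed

section \<open>Dual representations and the complementary fractional Haemers bound\<close>

definition vscale :: "'a::field \<Rightarrow> (nat \<Rightarrow> 'a) \<Rightarrow> nat \<Rightarrow> 'a" where
  "vscale c x = (\<lambda>i. c * x i)"

global_interpretation vs: vector_space "vscale :: 'a::field \<Rightarrow> (nat \<Rightarrow> 'a) \<Rightarrow> nat \<Rightarrow> 'a"
  by unfold_locales (auto simp: vscale_def fun_eq_iff algebra_simps)

text \<open>The space of \<open>n\<close>-tuples over \<open>'a\<close>: since \<open>n\<close> is quantified over below, all these spaces are
  realized inside the single type \<open>nat \<Rightarrow> 'a\<close>, as the sequences vanishing from index \<open>n\<close> on.\<close>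

definition vecs :: "nat \<Rightarrow> (nat \<Rightarrow> 'a::field) set" where
  "vecs n = {x. \<forall>i\<ge>n. x i = 0}"

text \<open>The sum of a family of subspaces is the span of their union (\<open>{0}\<close> for the empty family).\<close>

definition dual_representation ::
    "nat \<Rightarrow> nat \<Rightarrow> 'v graph \<Rightarrow> ('v \<Rightarrow> (nat \<Rightarrow> 'a::field) set) \<Rightarrow> bool" where
  "dual_representation n d G X \<longleftrightarrow>
    (\<forall>v\<in>verts G. X v \<subseteq> vecs n \<and> vs.subspace (X v) \<and> vs.dim (X v) = d \<and>
       X v \<inter> vs.span (\<Union>w\<in>neighbourhood G v. X w) = {0})"

text \<open>The condition \<open>d > 0\<close> is needed because \<open>n / 0 = 0\<close> in HOL. The type argument is the field.\<close>

definition compl_frac_haemers :: "'v graph \<Rightarrow> 'a::field itself \<Rightarrow> real" where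
  "compl_frac_haemers G (F :: 'a itself) =
    Inf {real n / real d |n d. d > 0 \<and>
      (\<exists>X :: 'v \<Rightarrow> (nat \<Rightarrow> 'a) set. dual_representation n d G X)}"

end

theory Submission
  imports Defs
begin

text \<open>The upper bound is attained by coordinate subspaces, that is, by a fractional colouring of
  the Mycielskian. For the lower bound, let \<open>f A\<close> be the dimension of the sum of the \<open>X v\<close> with
  \<open>v \<in> A\<close>, and put \<open>k = n - m d\<close>. For a vertex \<open>v\<close> of the complete graph let \<open>L v i\<close> consist of the
  copies at level \<open>i\<close> of the other vertices, and \<open>L v r\<close> of the apex; then \<open>L v (i - 1) \<union> L v (i + 1)\<close>
  (with \<open>L v 0\<close> for \<open>L v (- 1)\<close>) is the neighbourhood of \<open>Copy v i\<close>, so its rank is at most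
  \<open>n - d = (m - 1) d + k\<close>. Let \<open>h i\<close> bound the increment \<open>f (L v (i + 1) \<union> L v i) - f (L v i)\<close>.
  Submodularity, applied at \<open>L v (i - 1)\<close>, gives \<open>h i \<le> h (i - 1) + k + ((m - 1) d - f (L v i))\<close>, and
  each copy in \<open>L v i\<close> except one contributes to the last defect at most \<open>h (i - 1)\<close>. Hence
  \<open>h i \<le> k + (m - 1) h (i - 1)\<close>, while the apex forces \<open>h (r - 1) \<ge> d\<close>.\<close>

section \<open>Dimension inside the spaces of tuples\<close>

definition coords :: "nat set \<Rightarrow> (nat \<Rightarrow> 'a::field) set" where
  "coords T = {x. \<forall>i. i \<notin> T \<longrightarrow> x i = 0}"

definition unit_vec :: "nat \<Rightarrow> nat \<Rightarrow> 'a::field" where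
  "unit_vec j = (\<lambda>i. if i = j then 1 else 0)"

lemma vecs_eq_coords: "vecs n = coords {..<n}"
  by (auto simp: vecs_def coords_def)

lemma coords_mono: "S \<subseteq> T \<Longrightarrow> coords S \<subseteq> coords T"
  by (auto simp: coords_def)

lemma subspace_coords: "vs.subspace (coords T)"
  by (auto simp: vs.subspace_def coords_def vscale_def)

lemma unit_vec_in_coords: "j \<in> T \<Longrightarrow> unit_vec j \<in> coords T"
  by (auto simp: unit_vec_def coords_def)

lemma span_unit_vec_subset_coords: "vs.span (unit_vec ` T) \<subseteq> coords T"
  by (rule vs.span_minimal) (auto simp: unit_vec_in_coords subspace_coords)

text \<open>Independence and distinctness come from one fact: the span of the earlier unit vectors
  vanishes at the new index \<open>a\<close>, where \<open>unit_vec a\<close> does not.\<close>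

lemma coords_basis:
  assumes "finite T"
  shows "coords T \<subseteq> vs.span (unit_vec ` T :: (nat \<Rightarrow> 'a::field) set) \<and>
    vs.independent (unit_vec ` T :: (nat \<Rightarrow> 'a) set) \<and>
    card (unit_vec ` T :: (nat \<Rightarrow> 'a) set) = card T"
  using assms
proof (induction T rule: finite_induct)
  case empty
  show ?case
    using vs.independent_empty by (auto simp: coords_def vs.span_zero fun_eq_iff)
next
  case (insert a T)
  let ?U = "unit_vec ` T :: (nat \<Rightarrow> 'a) set"
  have notin: "unit_vec a \<notin> vs.span ?U"
  proof
    assume "(unit_vec a :: nat \<Rightarrow> 'a) \<in> vs.span ?U"
    then have "(unit_vec a :: nat \<Rightarrow> 'a) \<in> coords T"
      using span_unit_vec_subset_coords by blast
    with insert.hyps(2) show False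
      by (auto simp: coords_def unit_vec_def)
  qed
  then have "(unit_vec a :: nat \<Rightarrow> 'a) \<notin> ?U"
    using vs.span_base by blast
  moreover have "x \<in> vs.span (insert (unit_vec a) ?U)" if "x \<in> coords (insert a T)" for x
  proof -
    have "x - vscale (x a) (unit_vec a) \<in> coords T"
      using that by (auto simp: coords_def unit_vec_def vscale_def)
    then have "x - vscale (x a) (unit_vec a) \<in> vs.span ?U"
      using insert.IH by blast
    then show ?thesis
      by (rule vs.span_breakdown_eq[THEN iffD2, OF exI])
  qed
  ultimately show ?case
    using insert vs.independent_insertI[OF notin] by auto
qed

lemma dim_coords: "finite T \<Longrightarrow> vs.dim (coords T :: (nat \<Rightarrow> 'a::field) set) = card T"
  using coords_basis[of T, where ?'a = 'a] unit_vec_in_coords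
  by (intro vs.dim_unique[of "unit_vec ` T"]) auto

section \<open>Bases and dimension inequalities within \<open>vecs n\<close>\<close>

lemma finite_independent_vecs:
  assumes "vs.independent B" "B \<subseteq> vecs n"
  shows "finite (B :: (nat \<Rightarrow> 'a::field) set)"
proof -
  have "B \<subseteq> vs.span (unit_vec ` {..<n})"
    using assms(2) coords_basis[of "{..<n}"] by (auto simp: vecs_eq_coords)
  then show ?thesis
    using vs.independent_span_bound[of "unit_vec ` {..<n}" B] assms(1) by simp
qed

lemma vecs_basis_exists:
  fixes V :: "(nat \<Rightarrow> 'a::field) set"
  assumes "V \<subseteq> vecs n"
  obtains B where "B \<subseteq> V" "vs.independent B" "vs.span B = vs.span V" "finite B"
    "card B = vs.dim V"
proof -
  obtain B where B: "B \<subseteq> V" "vs.independent B" "V \<subseteq> vs.span B" "card B = vs.dim V"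
    by (rule vs.basis_exists)
  moreover have "finite B"
    using B assms by (intro finite_independent_vecs) auto
  moreover have "vs.span B = vs.span V"
    using B by (metis subset_antisym vs.span_minimal vs.span_mono vs.subspace_span)
  ultimately show ?thesis
    using that by blast
qed

text \<open>The ambient \<open>vecs n\<close> matters: \<open>vs.dim\<close> is 0 in infinite
  dimension, so monotonicity fails in general.\<close>

lemma dim_mono_vecs:
  assumes "V \<subseteq> W" "W \<subseteq> vecs n"
  shows "vs.dim V \<le> vs.dim (W :: (nat \<Rightarrow> 'a::field) set)"
proof -
  obtain B where B: "B \<subseteq> W" "vs.independent B" "vs.span B = vs.span W" "finite B"
      "card B = vs.dim W"
    by (rule vecs_basis_exists[OF assms(2)])
  have "V \<subseteq> vs.span B"
    using assms(1) B(3) vs.span_superset[of W] by auto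
  then show ?thesis
    using vs.dim_le_card[of V B] B(4,5) by simp
qed

lemma dim_le_vecs: "V \<subseteq> vecs n \<Longrightarrow> vs.dim (V :: (nat \<Rightarrow> 'a::field) set) \<le> n"
  using dim_mono_vecs[of V "vecs n" n] dim_coords[of "{..<n}", where ?'a = 'a]
  by (simp add: vecs_eq_coords)

text \<open>A basis \<open>P\<close> of the span of \<open>C\<close> extends to a basis
  \<open>Q\<close> of the span of \<open>B\<close>; a basis of the span of \<open>A\<close> together
  with \<open>Q - P\<close> then spans both sets.\<close>

lemma dim_submodular:
  fixes A B C :: "(nat \<Rightarrow> 'a::field) set"
  assumes "C \<subseteq> A" "C \<subseteq> B" "A \<subseteq> vecs n" "B \<subseteq> vecs n"
  shows "vs.dim (A \<union> B) + vs.dim C \<le> vs.dim A + vs.dim B"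
proof -
  have "C \<subseteq> vecs n"
    using assms by blast
  then obtain P where P: "P \<subseteq> C" "vs.independent P" "vs.span P = vs.span C" "finite P"
      "card P = vs.dim C"
    by (rule vecs_basis_exists)
  obtain Q where Q: "P \<subseteq> Q" "Q \<subseteq> B" "vs.independent Q" "B \<subseteq> vs.span Q"
    using vs.maximal_independent_subset_extend[OF _ P(2), of B] P(1) assms(2) by blast
  obtain R where R: "R \<subseteq> A" "vs.independent R" "vs.span R = vs.span A" "finite R"
      "card R = vs.dim A"
    by (rule vecs_basis_exists[OF assms(3)])
  have finQ: "finite Q"
    using finite_independent_vecs[OF Q(3)] Q(2) assms(4) by blast
  have "P \<subseteq> vs.span R"
    using P(1) R(3) assms(1) vs.span_superset[of A] by auto
  then have "Q \<subseteq> vs.span (R \<union> (Q - P))"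
    using vs.span_mono[of R "R \<union> (Q - P)"] vs.span_superset[of "R \<union> (Q - P)"] by blast
  then have "B \<subseteq> vs.span (R \<union> (Q - P))"
    using Q(4) vs.span_minimal[OF _ vs.subspace_span, of Q] by blast
  moreover have "A \<subseteq> vs.span (R \<union> (Q - P))"
    using R(3) vs.span_superset[of A] vs.span_mono[of R "R \<union> (Q - P)"] by blast
  ultimately have "vs.dim (A \<union> B) \<le> card (R \<union> (Q - P))"
    using R(4) finQ by (intro vs.dim_le_card) auto
  also have "\<dots> \<le> card R + card (Q - P)"
    by (rule card_Un_le)
  also have "card (Q - P) = vs.dim B - vs.dim C"
    using Q P(4,5) vs.basis_card_eq_dim[of Q B] by (simp add: card_Diff_subset)
  finally show ?thesis
    using R(5) dim_mono_vecs[OF assms(2,4)] by linarith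
qed

lemma independent_Un_span_trivial:
  fixes P Q :: "(nat \<Rightarrow> 'a::field) set"
  assumes "vs.independent P" "vs.independent Q" "vs.span P \<inter> vs.span Q \<subseteq> {0}"
  shows "vs.independent (P \<union> Q)"
proof -
  \<comment> \<open>Stated for arbitrary \<open>P\<close> and \<open>Q\<close>, so that swapping
    them covers a dependent vector on either side. If \<open>a = x + y\<close>, then
    \<open>y = a - x\<close> lies in both spans and vanishes.\<close>
  have *: False
    if ind: "vs.independent P" and triv: "vs.span P \<inter> vs.span Q \<subseteq> {0}"
      and a: "a \<in> P" "a \<in> vs.span (P \<union> Q - {a})" for a and P Q :: "(nat \<Rightarrow> 'a) set"
  proof -
    have "a \<in> vs.span ((P - {a}) \<union> Q)"
      using a(2) vs.span_mono[of "P \<union> Q - {a}" "(P - {a}) \<union> Q"] by blast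
    then obtain x y where xy: "a = x + y" "x \<in> vs.span (P - {a})" "y \<in> vs.span Q"
      by (auto simp: vs.span_Un)
    have "x \<in> vs.span P"
      using xy(2) vs.span_mono[of "P - {a}" P] by blast
    then have "a - x \<in> vs.span P"
      by (rule vs.span_diff[OF vs.span_base[OF a(1)]])
    then have "y = 0"
      using xy triv by auto
    then show False
      using ind a(1) xy by (auto simp: vs.dependent_def)
  qed
  show ?thesis
    unfolding vs.dependent_def
  proof
    assume "\<exists>a\<in>P \<union> Q. a \<in> vs.span (P \<union> Q - {a})"
    then show False
      using *[OF assms(1,3)] *[of Q P] assms by (auto simp: Un_commute Int_commute)
  qed
qed

text \<open>Turns the trivial intersection in a dual representation into a rank increment of at
  least \<open>d\<close>.\<close>

lemma dim_Un_span_trivial: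
  fixes A B :: "(nat \<Rightarrow> 'a::field) set"
  assumes "A \<subseteq> vecs n" "B \<subseteq> vecs n" "vs.span A \<inter> vs.span B \<subseteq> {0}"
  shows "vs.dim A + vs.dim B \<le> vs.dim (A \<union> B)"
proof -
  obtain P where P: "P \<subseteq> A" "vs.independent P" "vs.span P = vs.span A" "finite P"
      "card P = vs.dim A"
    by (rule vecs_basis_exists[OF assms(1)])
  obtain Q where Q: "Q \<subseteq> B" "vs.independent Q" "vs.span Q = vs.span B" "finite Q"
      "card Q = vs.dim B"
    by (rule vecs_basis_exists[OF assms(2)])
  have ind: "vs.independent (P \<union> Q)"
    using independent_Un_span_trivial[OF P(2) Q(2)] P(3) Q(3) assms(3) by simp
  have "P \<inter> Q \<subseteq> vs.span A \<inter> vs.span B"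
    using P(3) Q(3) vs.span_superset by blast
  moreover have "0 \<notin> P"
    using P(2) vs.dependent_zero by blast
  ultimately have "P \<inter> Q = {}"
    using assms(3) by auto
  then have "card (P \<union> Q) = vs.dim A + vs.dim B"
    using P Q by (simp add: card_Un_disjoint)
  moreover have "vs.dim (P \<union> Q) = card (P \<union> Q)"
    by (rule vs.dim_eq_card_independent[OF ind])
  moreover have "vs.dim (P \<union> Q) \<le> vs.dim (A \<union> B)"
    using P Q assms by (intro dim_mono_vecs[where n = n]) auto
  ultimately show ?thesis
    by simp
qed

section \<open>The extremal multicolouring\<close>

text \<open>The sum of the neighbours' coordinate subspaces is supported on the neighbours' colours,
  and these avoid \<open>T v\<close>.\<close>

lemma dual_representation_of_multicolouring:
  assumes "\<And>v. v \<in> verts G \<Longrightarrow> T v \<subseteq> {..<n} \<and> card (T v) = d"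
    and "\<And>v w. {v, w} \<in> edges G \<Longrightarrow> T v \<inter> T w = {}"
  shows "dual_representation n d G (\<lambda>v. coords (T v) :: (nat \<Rightarrow> 'a::field) set)"
  unfolding dual_representation_def
proof (intro ballI conjI)
  fix v assume v: "v \<in> verts G"
  let ?N = "\<Union>w\<in>neighbourhood G v. T w"
  show "coords (T v) \<subseteq> (vecs n :: (nat \<Rightarrow> 'a) set)"
    using assms(1)[OF v] by (auto simp: vecs_eq_coords intro: coords_mono[THEN subsetD])
  show "vs.subspace (coords (T v) :: (nat \<Rightarrow> 'a) set)"
    by (rule subspace_coords)
  show "vs.dim (coords (T v) :: (nat \<Rightarrow> 'a) set) = d"
    using assms(1)[OF v] dim_coords finite_subset by blast
  have "vs.span (\<Union>w\<in>neighbourhood G v. coords (T w)) \<subseteq> (coords ?N :: (nat \<Rightarrow> 'a) set)"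
    by (rule vs.span_minimal[OF _ subspace_coords]) (auto simp: coords_def)
  moreover have "T v \<inter> ?N = {}"
    using assms(2) by (auto simp: neighbourhood_def)
  then have "coords (T v) \<inter> coords ?N = ({0} :: (nat \<Rightarrow> 'a) set)"
    by (auto simp: coords_def fun_eq_iff) blast
  ultimately show "coords (T v) \<inter> vs.span (\<Union>w\<in>neighbourhood G v. coords (T w)) =
      ({0} :: (nat \<Rightarrow> 'a) set)"
    using subspace_coords[of "T v"] by (auto simp: vs.span_zero vs.subspace_0)
qed

text \<open>Partial sums of the powers of \<open>m - 1\<close> in Horner form: the recursion met
  both in the colour count and in the lower bound.\<close>

fun geo :: "nat \<Rightarrow> nat \<Rightarrow> nat" where
  "geo m 0 = 0"
| "geo m (Suc i) = 1 + (m - 1) * geo m i"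

lemma geo_mono_Suc: "m > 0 \<Longrightarrow> geo m i \<le> geo m (Suc i)"
proof (induction i)
  case (Suc i)
  then have "1 + (m - 1) * geo m i \<le> 1 + (m - 1) * geo m (Suc i)"
    by (intro add_left_mono mult_le_mono2)
  then show ?case
    by (simp only: geo.simps(2))
qed simp

lemma geo_mono: "m > 0 \<Longrightarrow> i \<le> j \<Longrightarrow> geo m i \<le> geo m j"
  using lift_Suc_mono_le[of "geo m"] geo_mono_Suc by blast

lemma geo_eq_sum:
  assumes "m > 0"
  shows "real (geo m (Suc i)) = (\<Sum>k=0..i. (real m - 1) ^ k)"
proof (induction i)
  case (Suc i)
  have "(\<Sum>k=0..Suc i. (real m - 1) ^ k) = 1 + (real m - 1) * (\<Sum>k=0..i. (real m - 1) ^ k)"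
    by (subst sum.atLeast_Suc_atMost)
      (simp_all only: sum.shift_bounds_cl_Suc_ivl sum_distrib_left, simp_all)
  moreover have "real (geo m (Suc (Suc i))) = 1 + (real m - 1) * real (geo m (Suc i))"
    using assms by (subst geo.simps(2)) (simp add: of_nat_diff del: geo.simps)
  ultimately show ?case
    using Suc.IH by simp
qed simp

text \<open>With \<open>S = geo m r\<close>, the colours \<open>v S, \<dots>, v S + S - 1\<close> belong to the vertex \<open>v\<close> of the
  complete graph and the colour \<open>m S\<close> is spare. At level \<open>i\<close>, the vertex \<open>v\<close> still uses all but the
  first \<open>geo m i\<close> of its own colours; the missing ones are replaced by the set \<open>common m S i\<close>,
  which consists of the colours not occurring at the previous level.\<close>

definition own :: "nat \<Rightarrow> nat \<Rightarrow> nat \<Rightarrow> nat \<Rightarrow> nat set" where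
  "own m S i v = {v * S + geo m i..<v * S + S}"

fun common :: "nat \<Rightarrow> nat \<Rightarrow> nat \<Rightarrow> nat set" where
  "common m S 0 = {}"
| "common m S (Suc i) = {..m * S} - (common m S i \<union> (\<Union>v<m. own m S i v))"

section \<open>Disjointness and size of the colour sets\<close>

lemma own_subset: "v < m \<Longrightarrow> own m S i v \<subseteq> {..m * S}"
proof -
  assume "v < m"
  then have "Suc v * S \<le> m * S"
    by (intro mult_right_mono) auto
  then show ?thesis
    by (auto simp: own_def)
qed

lemma own_disjoint:
  assumes "v \<noteq> w"
  shows "own m S i v \<inter> own m S j w = {}"
proof -
  \<comment> \<open>Division by \<open>S\<close> recovers a vertex from any of its own colours,
    whatever the level.\<close>
  have "x div S = u" if "x \<in> own m S i u" for x u i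
    using that by (intro div_nat_eqI) (auto simp: own_def algebra_simps)
  then show ?thesis
    using assms by blast
qed

lemma own_Suc_subset: "m > 0 \<Longrightarrow> own m S (Suc i) v \<subseteq> own m S i v"
  using geo_mono_Suc[of m i] by (auto simp: own_def simp del: geo.simps)

lemma common_subset: "common m S i \<subseteq> {..m * S}"
  by (cases i) auto

text \<open>\<open>common\<close> avoids the own colours of the previous level, and own colours only
  shrink as the level rises.\<close>

lemma common_own_disjoint: "m > 0 \<Longrightarrow> v < m \<Longrightarrow> common m S i \<inter> own m S i v = {}"
  using own_Suc_subset[of m S _ v] by (cases i) auto

lemma card_common:
  assumes "m > 0" "i > 0 \<Longrightarrow> geo m (i - 1) \<le> S"
  shows "card (common m S i) = geo m i"
  using assms(2)
proof (induction i)
  case (Suc i)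
  have le: "geo m i \<le> S"
    using Suc.prems by simp
  have "geo m (i - 1) \<le> S"
    using le geo_mono[of m "i - 1" i] assms(1) by linarith
  then have IH: "card (common m S i) = geo m i"
    using Suc.IH by blast
  have "card (\<Union>v<m. own m S i v) = (\<Sum>v<m. card (own m S i v))"
    using own_disjoint by (intro card_UN_disjoint) (auto simp: own_def)
  then have own: "card (\<Union>v<m. own m S i v) = m * (S - geo m i)"
    by (simp add: own_def)
  have fin: "finite (common m S i)" "finite (\<Union>v<m. own m S i v)"
    using finite_subset[OF common_subset] by (simp_all add: own_def)
  have "card (common m S i \<union> (\<Union>v<m. own m S i v)) = geo m i + m * (S - geo m i)"
    using common_own_disjoint[OF assms(1)] fin by (subst card_Un_disjoint) (auto simp: own IH)
  moreover have "common m S i \<union> (\<Union>v<m. own m S i v) \<subseteq> {..m * S}"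
    using common_subset own_subset by blast
  ultimately have "card (common m S (Suc i)) = Suc (m * S) - (geo m i + m * (S - geo m i))"
    using fin by (subst common.simps, subst card_Diff_subset) auto
  also have "\<dots> = geo m (Suc i)"
  proof -
    obtain t where "S = geo m i + t"
      using le le_Suc_ex by blast
    moreover obtain M where "m = Suc M"
      using assms(1) gr0_implies_Suc by blast
    ultimately show ?thesis
      by (simp add: algebra_simps)
  qed
  finally show ?case .
qed simp

text \<open>The apex acts as a level \<open>r\<close> merged into one vertex: for
  \<open>S = geo m r\<close> the own colours have run out there and only \<open>common\<close>
  remains.\<close>

fun colouring :: "nat \<Rightarrow> nat \<Rightarrow> nat myc \<Rightarrow> nat set" where
  "colouring m r (Copy v i) = own m (geo m r) i v \<union> common m (geo m r) i"
| "colouring m r Apex = common m (geo m r) r"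

lemma edges_complete_graph: "{v, w} \<in> edges (complete_graph m) \<longleftrightarrow> v < m \<and> w < m \<and> v \<noteq> w"
  by (auto simp: complete_graph_def doubleton_eq_iff)

lemma colouring_disjoint_Suc:
  assumes "v < m" "w < m" "v \<noteq> w"
  shows "colouring m r (Copy v i) \<inter> colouring m r (Copy w (Suc i)) = {}"
proof -
  let ?S = "geo m r"
  have "m > 0" using assms by simp
  have "own m ?S i v \<inter> common m ?S (Suc i) = {}" "common m ?S i \<inter> common m ?S (Suc i) = {}"
    using assms(1) by auto
  moreover have "common m ?S i \<inter> own m ?S (Suc i) w = {}"
    using common_own_disjoint[OF \<open>m > 0\<close> assms(2)] own_Suc_subset[OF \<open>m > 0\<close>] by blast
  ultimately show ?thesis
    using own_disjoint[OF assms(3), of m ?S i "Suc i"] by (auto simp del: common.simps)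
qed

lemma dual_representation_mycielskian:
  assumes "m > 0" "r > 0"
  shows "\<exists>X :: nat myc \<Rightarrow> (nat \<Rightarrow> 'a::field) set.
    dual_representation (m * geo m r + 1) (geo m r) (mycielskian r (complete_graph m)) X"
proof (rule exI, rule dual_representation_of_multicolouring[where T = "colouring m r"])
  let ?S = "geo m r"
  fix x assume x: "x \<in> verts (mycielskian r (complete_graph m))"
  show "colouring m r x \<subseteq> {..<m * ?S + 1} \<and> card (colouring m r x) = ?S"
  proof (cases x)
    case (Copy v i)
    have vi: "v < m" "i < r"
      using x Copy by (auto simp: mycielskian_def complete_graph_def)
    have "geo m (i - 1) \<le> ?S" "geo m i \<le> ?S"
      using geo_mono assms vi by simp_all
    then have "card (colouring m r x) = ?S"
      using Copy common_own_disjoint[OF assms(1) vi(1)] card_common[OF assms(1), of i ?S]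
        finite_subset[OF common_subset]
      by (subst Copy, simp, subst card_Un_disjoint) (auto simp: own_def)
    then show ?thesis
      using own_subset[OF vi(1)] common_subset Copy by (fastforce simp: lessThan_Suc_atMost)
  next
    case Apex
    then show ?thesis
      using common_subset[of m ?S r] card_common[OF assms(1), of r ?S] geo_mono[OF assms(1)]
      by (auto simp: lessThan_Suc_atMost)
  qed
next
  fix x y assume "{x, y} \<in> edges (mycielskian r (complete_graph m))"
  then consider
    (base) v w where "{x, y} = {Copy v 0, Copy w 0}" "v < m" "w < m" "v \<noteq> w"
    | (level) v w i j where "{x, y} = {Copy v i, Copy w j}" "v < m" "w < m" "v \<noteq> w"
        "\<bar>int i - int j\<bar> = 1"
    | (apex) v where "{x, y} = {Copy v (r - 1), Apex}" "v < m"
    by (auto simp: mycielskian_def edges_complete_graph) (auto simp: complete_graph_def)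
  then show "colouring m r x \<inter> colouring m r y = {}"
  proof cases
    case base
    \<comment> \<open>\<open>common\<close> is empty at level 0, so disjointness of own colours
      suffices.\<close>
    then show ?thesis
      using own_disjoint by (fastforce simp: doubleton_eq_iff)
  next
    case level
    then have "j = Suc i \<or> i = Suc j"
      by linarith
    then show ?thesis
      using level colouring_disjoint_Suc by (metis Int_commute doubleton_eq_iff)
  next
    case apex
    \<comment> \<open>By construction \<open>common\<close> at level \<open>r\<close> omits every
      colour used at level \<open>r - 1\<close>.\<close>
    have "colouring m r (Copy v (r - 1)) \<inter> colouring m r Apex = {}"
      using assms(2) apex(2) by (cases r) auto
    then show ?thesis
      using apex by (metis Int_commute doubleton_eq_iff)
  qed
qed

section \<open>The lower bound\<close>

text \<open>Linear algebra enters only through these four properties of the rank. \<open>nbr\<close>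
  allows subsets of a neighbourhood because rows are built up one copy at a time.\<close>

lemma submodular_bound:
  fixes f :: "nat myc set \<Rightarrow> nat" and m r n d :: nat
  defines "G \<equiv> mycielskian r (complete_graph m)"
  assumes m: "m > 0" and r: "r > 0"
    and mono: "\<And>A B. A \<subseteq> B \<Longrightarrow> B \<subseteq> verts G \<Longrightarrow> f A \<le> f B"
    and submod: "\<And>A B C. C \<subseteq> A \<Longrightarrow> C \<subseteq> B \<Longrightarrow> A \<subseteq> verts G \<Longrightarrow> B \<subseteq> verts G \<Longrightarrow>
      f (A \<union> B) + f C \<le> f A + f B"
    and bound: "\<And>A. A \<subseteq> verts G \<Longrightarrow> f A \<le> n"
    and nbr: "\<And>v A. v \<in> verts G \<Longrightarrow> A \<subseteq> verts G \<Longrightarrow> A \<subseteq> neighbourhood G v \<Longrightarrow>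
      d + f A \<le> f (insert v A)"
  shows "int d \<le> (int n - int m * int d) * int (geo m r)"
proof -
  \<comment> \<open>A priori \<open>k\<close> may be negative, hence the integers.\<close>
  define k where "k = int n - int m * int d"
  define row where "row i W = (\<lambda>w. Copy w i) ` W" for i :: nat and W :: "nat set"
  define L where "L v i = (if i < r then row i ({..<m} - {v}) else {Apex})" for v i
  have row_verts: "row i W \<subseteq> verts G" if "i < r" "W \<subseteq> {..<m}" for i W
    using that by (auto simp: G_def row_def mycielskian_def complete_graph_def)
  have L_verts: "L v i \<subseteq> verts G" for v i
    using row_verts[of i "{..<m} - {v}"] by (auto simp: L_def G_def mycielskian_def)
  have Copy_verts: "Copy v i \<in> verts G" if "v < m" "i < r" for v i
    using that by (auto simp: G_def mycielskian_def complete_graph_def)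
  have nbr_base: "row 0 ({..<m} - {v}) \<subseteq> neighbourhood G (Copy v 0)" if "v < m" for v
    using that by (auto simp: G_def row_def neighbourhood_def mycielskian_def edges_complete_graph)
  have adj: "Copy w j \<in> neighbourhood G (Copy v i)"
    if "v < m" "w < m" "v \<noteq> w" "i < r" "j < r" "\<bar>int i - int j\<bar> = 1" for v w i j
  proof -
    have "{Copy v i, Copy w j} \<in> {{Copy v i, Copy w j} |v w i j.
        {v, w} \<in> edges (complete_graph m) \<and> i < r \<and> j < r \<and> \<bar>int i - int j\<bar> = 1}"
      using that edges_complete_graph by blast
    then show ?thesis
      by (simp add: G_def neighbourhood_def mycielskian_def)
  qed
  have nbr_down: "L v i \<subseteq> neighbourhood G (Copy v (Suc i))" if "v < m" "Suc i < r" for v i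
    using that by (auto simp: L_def row_def intro!: adj)
  have nbr_up: "L v (Suc i) \<subseteq> neighbourhood G (Copy v i)" if "v < m" "i < r" for v i
  proof (cases "Suc i < r")
    case True
    then show ?thesis
      using that by (auto simp: L_def row_def intro!: adj)
  next
    case False
    then have "i = r - 1"
      using that by simp
    then show ?thesis
      using that False
      by (auto simp: L_def G_def neighbourhood_def mycielskian_def complete_graph_def)
  qed
  have nbr_apex: "L v (r - 1) \<subseteq> neighbourhood G Apex" for v
    using r by (auto simp: L_def row_def G_def neighbourhood_def mycielskian_def
        complete_graph_def insert_commute)
  have Un_le: "f A + d \<le> n"
    if "v < m" "i < r" "A \<subseteq> verts G" "A \<subseteq> neighbourhood G (Copy v i)" for v i A
    using nbr[OF Copy_verts[OF that(1,2)] that(3,4)] bound[of "insert (Copy v i) A"]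
      Copy_verts[OF that(1,2)] that(3) by auto

  text \<open>Conditioning on a larger set only decreases the increment, and the increment of
    \<open>Copy v (Suc i)\<close> over \<open>L v i\<close> is \<open>d\<close>, so what is lost over \<open>L v (Suc i)\<close> is at most the increment
    of \<open>L v (Suc i)\<close> over \<open>L v i\<close>.\<close>
  have row_step: "int (f (insert (Copy v (Suc i)) A)) \<ge> int (f A) + int d - c"
    if v: "v < m" and i: "Suc i < r" and A: "A \<subseteq> L v (Suc i)"
      and c: "int (f (L v (Suc i) \<union> L v i)) - int (f (L v i)) \<le> c" for v i A c
  proof -
    let ?x = "Copy v (Suc i)" and ?B = "L v (Suc i) \<union> L v i"
    have xV: "?x \<in> verts G"
      using Copy_verts v i by simp
    have "d + f (L v i) \<le> f (insert ?x (L v i))"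
      using nbr[OF xV L_verts nbr_down] v i by blast
    also have "\<dots> \<le> f (insert ?x ?B)"
      using xV L_verts by (intro mono) auto
    finally have "d + f (L v i) \<le> f (insert ?x ?B)" .
    moreover have "f (insert ?x A \<union> ?B) + f A \<le> f (insert ?x A) + f ?B"
      using A xV L_verts by (intro submod) blast+
    moreover have "insert ?x A \<union> ?B = insert ?x ?B"
      using A by blast
    ultimately show ?thesis
      using c by simp
  qed
  \<comment> \<open>The first copy contributes all of \<open>d\<close>, each later one loses at most
    the bound from \<open>prev\<close>. At level 0 nothing is lost: \<open>prev\<close> is vacuous
    and \<open>geo m 0 = 0\<close>.\<close>
  have row_bound: "int (f (row i W)) \<ge> int (card W) * int d - int (card W - 1) * (k * int (geo m i))"
    if i: "i < r" and W: "W \<subseteq> {..<m}"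
      and prev: "\<And>v j. v < m \<Longrightarrow> i = Suc j \<Longrightarrow>
        int (f (L v i \<union> L v j)) - int (f (L v j)) \<le> k * int (geo m i)" for i W
  proof -
    have "finite W"
      using W finite_subset by blast
    then show ?thesis
      using W
    proof (induction W rule: finite_induct)
      case (insert v W)
      have v: "v < m" and sub: "row i W \<subseteq> row i ({..<m} - {v})"
        using insert by (auto simp: row_def)
      have ins: "row i (insert v W) = insert (Copy v i) (row i W)"
        by (simp add: row_def)
      show ?case
      proof (cases "W = {}")
        case True
        then show ?thesis
          using nbr[OF Copy_verts[OF v i], of "{}"] by (simp add: row_def)
      next
        case False
        have "int (f (insert (Copy v i) (row i W))) \<ge> int (f (row i W)) + int d - k * int (geo m i)"
        proof (cases i)
          case 0
          have "d + f (row i W) \<le> f (insert (Copy v i) (row i W))"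
            using nbr_base[OF v] sub row_verts[OF i] insert.prems 0
            by (intro nbr Copy_verts v i) auto
          then show ?thesis
            using 0 by simp
        next
          case (Suc j)
          then show ?thesis
            using row_step[of v j "row i W"] prev[OF v Suc] v i sub by (simp add: L_def)
        qed
        moreover have "int (card W - 1) = int (card W) - 1"
          using False insert.hyps by (simp add: Suc_leI card_gt_0_iff of_nat_diff)
        moreover have "int (f (row i W)) \<ge>
            int (card W) * int d - int (card W - 1) * (k * int (geo m i))"
          using insert by simp
        ultimately show ?thesis
          using insert.hyps by (simp add: ins algebra_simps)
      qed
    qed simp
  qed
  \<comment> \<open>The bound \<open>h i\<close> is \<open>k * geo m (Suc i)\<close>, which solves
    the recursion \<open>h i = k + (m - 1) * h (i - 1)\<close> with \<open>h 0 = k\<close>.\<close>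
  have step: "int (f (L v (Suc i) \<union> L v i)) - int (f (L v i)) \<le> k * int (geo m (Suc i))"
    if "i < r" "v < m" for i v
    using that
  proof (induction i arbitrary: v)
    case 0
    have "int (f (L v 0)) \<ge> int (m - 1) * int d"
      using row_bound[of 0 "{..<m} - {v}"] 0 by (simp add: L_def)
    moreover have "f (L v (Suc 0) \<union> L v 0) + d \<le> n"
    proof (rule Un_le[of v 0])
      show "L v (Suc 0) \<union> L v 0 \<subseteq> verts G"
        using L_verts by blast
      show "L v (Suc 0) \<union> L v 0 \<subseteq> neighbourhood G (Copy v 0)"
        using nbr_up[of v 0] nbr_base[of v] 0 by (simp add: L_def[of v 0])
    qed (use 0 in auto)
    ultimately show ?case
      using m by (simp add: k_def of_nat_diff algebra_simps)
  next
    case (Suc i)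
    let ?g = "k * int (geo m (Suc i))"
    have IH: "int (f (L w (Suc i) \<union> L w i)) - int (f (L w i)) \<le> ?g" if "w < m" for w
      using Suc that by simp
    have "f (L v (Suc (Suc i)) \<union> L v i) + d \<le> n"
      using nbr_up[of v "Suc i"] nbr_down[of v i] L_verts Suc.prems
      by (intro Un_le[of v "Suc i"]) auto
    \<comment> \<open>Submodularity over the common part \<open>L v i\<close>: the two outer levels
      lie in one neighbourhood, which bounds their joint rank by \<open>n - d\<close>.\<close>
    moreover have "f ((L v (Suc i) \<union> L v i) \<union> (L v (Suc (Suc i)) \<union> L v i)) + f (L v i)
        \<le> f (L v (Suc i) \<union> L v i) + f (L v (Suc (Suc i)) \<union> L v i)"
      using L_verts by (intro submod) auto
    moreover have "f (L v (Suc (Suc i)) \<union> L v (Suc i))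
        \<le> f ((L v (Suc i) \<union> L v i) \<union> (L v (Suc (Suc i)) \<union> L v i))"
      using L_verts by (intro mono) auto
    ultimately have *: "int (f (L v (Suc (Suc i)) \<union> L v (Suc i))) - int (f (L v (Suc i)))
        \<le> (int (f (L v (Suc i) \<union> L v i)) - int (f (L v i))) + (int n - int d) - int (f (L v (Suc i)))"
      by linarith
    have "int (f (row (Suc i) ({..<m} - {v}))) \<ge>
        int (card ({..<m} - {v})) * int d - int (card ({..<m} - {v}) - 1) * ?g"
      using IH Suc.prems(1) by (intro row_bound) auto
    then have "int (f (L v (Suc i))) \<ge> int (m - 1) * int d - int (m - 1 - 1) * ?g"
      using Suc.prems by (simp add: L_def del: geo.simps)
    moreover have "int n - int d = int (m - 1) * int d + k"
      using m by (simp add: k_def of_nat_diff algebra_simps)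
    ultimately have **: "int (f (L v (Suc (Suc i)) \<union> L v (Suc i))) - int (f (L v (Suc i)))
        \<le> (int (f (L v (Suc i) \<union> L v i)) - int (f (L v i))) + k + int (m - 1 - 1) * ?g"
      using * by linarith
    show ?case
    \<comment> \<open>For \<open>m = 1\<close> the truncated \<open>m - 1 - 1\<close> is 0 instead
      of -1, but the rows are empty, so the previous increment vanishes and only \<open>k\<close> is
      left.\<close>
    proof (cases "m = 1")
      case True
      then have "L v (Suc i) = {}" "L v i = {}"
        using Suc.prems by (auto simp: L_def row_def)
      then show ?thesis
        using ** True by simp
    next
      case False
      then have "int (m - 1 - 1) = int (m - 1) - 1"
        using m by (simp add: of_nat_diff)
      moreover have "x * y + x + (p - 1) * (x * y) = x * (1 + p * y)" for x y p :: int
        by (simp add: algebra_simps)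
      ultimately have "?g + k + int (m - 1 - 1) * ?g = k * (1 + int (m - 1) * int (geo m (Suc i)))"
        by (simp only:)
      also have "1 + int (m - 1) * int (geo m (Suc i)) = int (geo m (Suc (Suc i)))"
        by (subst (2) geo.simps(2)) (simp only: of_nat_add of_nat_mult of_nat_1)
      finally have "k * int (geo m (Suc (Suc i))) = ?g + k + int (m - 1 - 1) * ?g" ..
      then show ?thesis
        using ** IH[OF Suc.prems(2)] by linarith
    qed
  qed
  \<comment> \<open>The apex adds at least \<open>d\<close> to \<open>L 0 (r - 1)\<close>, while
    \<open>step\<close> at \<open>r - 1\<close> caps this increment by
    \<open>k * geo m r\<close>.\<close>
  have "d + f (L 0 (r - 1)) \<le> f (insert Apex (L 0 (r - 1)))"
    using L_verts nbr_apex by (intro nbr) (auto simp: G_def mycielskian_def)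
  moreover have "L 0 r \<union> L 0 (r - 1) = insert Apex (L 0 (r - 1))"
    by (simp add: L_def)
  ultimately show ?thesis
    using step[of "r - 1" 0] m r by (simp add: k_def del: geo.simps)
qed

lemma dual_representation_mycielskian_bound:
  fixes X :: "nat myc \<Rightarrow> (nat \<Rightarrow> 'a::field) set"
  assumes "m > 0" "r > 0"
    and X: "dual_representation n d (mycielskian r (complete_graph m)) X"
  shows "int d \<le> (int n - int m * int d) * int (geo m r)"
proof (rule submodular_bound[OF assms(1,2), where f = "\<lambda>A. vs.dim (\<Union>v\<in>A. X v)"])
  let ?V = "verts (mycielskian r (complete_graph m))"
  have sub: "(\<Union>v\<in>A. X v) \<subseteq> vecs n" if "A \<subseteq> ?V" for A
    using X that by (fastforce simp: dual_representation_def)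
  show "vs.dim (\<Union>v\<in>A. X v) \<le> vs.dim (\<Union>v\<in>B. X v)" if "A \<subseteq> B" "B \<subseteq> ?V" for A B
    using that sub by (intro dim_mono_vecs[where n = n]) auto
  show "vs.dim (\<Union>v\<in>A \<union> B. X v) + vs.dim (\<Union>v\<in>C. X v) \<le>
      vs.dim (\<Union>v\<in>A. X v) + vs.dim (\<Union>v\<in>B. X v)"
    if "C \<subseteq> A" "C \<subseteq> B" "A \<subseteq> ?V" "B \<subseteq> ?V" for A B C
    unfolding UN_Un using that sub by (intro dim_submodular[where n = n]) auto
  show "vs.dim (\<Union>v\<in>A. X v) \<le> n" if "A \<subseteq> ?V" for A
    by (rule dim_le_vecs[OF sub[OF that]])
  show "d + vs.dim (\<Union>v\<in>A. X v) \<le> vs.dim (\<Union>v\<in>insert v A. X v)"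
    if v: "v \<in> ?V" and A: "A \<subseteq> ?V"
      "A \<subseteq> neighbourhood (mycielskian r (complete_graph m)) v" for v A
  proof -
    have Xv: "X v \<subseteq> vecs n" "vs.subspace (X v)" "vs.dim (X v) = d"
      and triv: "X v \<inter>
        vs.span (\<Union>w\<in>neighbourhood (mycielskian r (complete_graph m)) v. X w) = {0}"
      using X[unfolded dual_representation_def, rule_format, OF v] by simp_all
    have "vs.span (\<Union>w\<in>A. X w) \<subseteq>
        vs.span (\<Union>w\<in>neighbourhood (mycielskian r (complete_graph m)) v. X w)"
      using A(2) by (intro vs.span_mono) blast
    then have "X v \<inter> vs.span (\<Union>w\<in>A. X w) \<subseteq> {0}"
      using triv by blast
    then have "vs.span (X v) \<inter> vs.span (\<Union>w\<in>A. X w) \<subseteq> {0}"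
      using vs.span_eq_iff[THEN iffD2, OF Xv(2)] by (simp only:)
    then show ?thesis
      using dim_Un_span_trivial[OF Xv(1) sub[OF A(1)]] Xv(3) by simp
  qed
qed

theorem theorem2:
  fixes m r :: nat
  assumes "m > 0" and "r > 0"
  shows "compl_frac_haemers (mycielskian r (complete_graph m)) TYPE('a::field) =
    real m + 1 / (\<Sum>k=0..r-1. (real m - 1) ^ k)"
proof -
  let ?S = "geo m r"
  have S: "real ?S = (\<Sum>k=0..r-1. (real m - 1) ^ k)"
    using geo_eq_sum[OF assms(1), of "r - 1"] assms(2) by simp
  have "?S > 0"
    using assms(2) by (cases r) auto
  have "compl_frac_haemers (mycielskian r (complete_graph m)) TYPE('a) = real m + 1 / real ?S"
    unfolding compl_frac_haemers_def
  \<comment> \<open>The colouring attains the infimum, so no limit is involved.\<close>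
  proof (rule cInf_eq_minimum)
    have "real m + 1 / real ?S = real (m * ?S + 1) / real ?S"
      using \<open>?S > 0\<close> by (simp add: field_simps)
    then show "real m + 1 / real ?S \<in> {real n / real d |n d. d > 0 \<and>
        (\<exists>X :: nat myc \<Rightarrow> (nat \<Rightarrow> 'a) set.
          dual_representation n d (mycielskian r (complete_graph m)) X)}"
      using dual_representation_mycielskian[OF assms] \<open>?S > 0\<close> by blast
  next
    fix x
    assume "x \<in> {real n / real d |n d. d > 0 \<and>
        (\<exists>X :: nat myc \<Rightarrow> (nat \<Rightarrow> 'a) set.
          dual_representation n d (mycielskian r (complete_graph m)) X)}"
    then obtain n d and X :: "nat myc \<Rightarrow> (nat \<Rightarrow> 'a) set" where x: "x = real n / real d" "d > 0"
      and X: "dual_representation n d (mycielskian r (complete_graph m)) X"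
      by blast
    have "real_of_int (int d) \<le> real_of_int ((int n - int m * int d) * int ?S)"
      using dual_representation_mycielskian_bound[OF assms X] by (simp only: of_int_le_iff)
    then have "real d \<le> (real n - real m * real d) * real ?S"
      by simp
    then have "real d * (1 + real m * real ?S) \<le> real d * (x * real ?S)"
      using x by (simp add: algebra_simps)
    then have "1 + real m * real ?S \<le> x * real ?S"
      using x(2) by simp
    then show "real m + 1 / real ?S \<le> x"
      using \<open>?S > 0\<close> by (simp add: field_simps)
  qed
  then show ?thesis
    by (simp add: S)
qed

end
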